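(* Let $\mathcal{L}:\mathcal{P}\to\mathbb{C}$ be a linear functional with complex moments $m_k=\mathcal{L}(\lambda^k)$, $k=0,1,\dots$. Let $p_0(\lambda),p_1(\lambda),\dots$ be an associated sequence of polynomials (as defined in the context), let $\nu(0)=0<\nu(1)<\nu(2)<\cdots$ be the indexes of the regular formal orthogonal polynomials, and let $T_n$ be the $n\times n$ block tridiagonal matrix associated with $p_0(\lambda),\dots,p_n(\lambda)$. For every integer $n\ge\nu(1)$, let $t$ be such that $\nu(t)\le n<\nu(t+1)$ (with $\nu(t+1)=+\infty$ when $p_{\nu(t)}$ is the last regular formal orthogonal polynomial). Then $$\mu\, m_{\nu(1)-1}\,\mathbf{e}_1^T (T_n)^k\,\mathbf{e}_{\nu(1)}=m_k,\qquad k=0,\dots,\nu(t)+\nu(t+1)-2,$$ where $\mu=(\beta_1\cdots\beta_{\nu(1)-1})^{-1}$ if $\nu(1)>1$ and $\mu=1$ if $\nu(1)=1$. (When $\nu(t+1)=+\infty$ the equality holds for all $k\ge 0$.)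
   Context: $\mathcal{P}$ is the space of polynomials in $\lambda$ with complex coefficients. The subindex of $p_n$ denotes its (exact) degree. $\mathbf{e}_i$ is the $i$th vector of the canonical basis of $\mathbb{C}^n$. For $k\ge1$ let $H_{k-1}=[m_{i+j}]_{i,j=0}^{k-1}$ be the $k\times k$ Hankel matrix of moments of $\mathcal{L}$ and $\Delta_{k-1}=\det H_{k-1}$. A polynomial $p_n$ of degree $n$ is a formal orthogonal polynomial (FOP) with respect to $\mathcal{L}$ if $\mathcal{L}(p_n\lambda^j)=0$ for $j=0,\dots,n-1$; it is called regular if $\Delta_{n-1}\neq0$ (equivalently, it is unique up to a nonzero scalar factor). Every nonzero constant $p_0$ is regarded as a regular FOP. A polynomial $p_n$ of degree $n$ is $k$-quasi-orthogonal if $\mathcal{L}(p_n\lambda^j)=0$ for $j=0,\dots,n-k-1$. Let $\nu(0)=0$ and let $\nu(1)<\nu(2)<\cdots$ be all integers $n\ge1$ with $\Delta_{n-1}\ne0$; set $\nu(t+1)=+\infty$ if $\nu(t)$ is the last such index. An associated sequence $p_0,p_1,p_2,\dots$ is any sequence of polynomials, $\deg p_n=n$, such that $p_{\nu(t)}$ is a regular FOP for every $t$, and $p_n$ is $(n-\nu(t))$-quasi-orthogonal for $\nu(t)<n<\nu(t+1)$ (for $\nu(0)=0<n<\nu(1)$ this imposes no condition on $p_n$ other than its degree). Such a sequence satisfies recurrences with uniquely determined coefficients, $\beta_n\neq0$: for $\nu(j)<n<\nu(j+1)$, $$\beta_n p_n(\lambda)=\lambda p_{n-1}(\lambda)-\sum_{i=\nu(j)}^{n-1}\alpha_{n,i}\,p_i(\lambda),$$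 and for $n=\nu(j+1)$, $j\ge0$, $$\beta_n p_n(\lambda)=\lambda p_{n-1}(\lambda)-\sum_{i=\nu(j)}^{n-1}\alpha_{n,i}\,p_i(\lambda)-\gamma_n\,p_{\nu(j-1)}(\lambda),$$ with $\gamma_{\nu(1)}=0$ and $p_{\nu(-1)}=0$. The matrix $T_n\in\mathbb{C}^{n\times n}$ is the matrix with $\lambda\,\mathbf{p}(\lambda)=T_n\,\mathbf{p}(\lambda)+\beta_n p_n(\lambda)\mathbf{e}_n$, $\mathbf{p}=[p_0,\dots,p_{n-1}]^T$. Explicitly: for $1\le m\le n$ and $j$ with $\nu(j)<m\le\nu(j+1)$, row $m$ of $T_n$ has entry $\beta_m$ in column $m+1$ (if $m<n$), entries $\alpha_{m,i}$ in columns $i+1$ for $i=\nu(j),\dots,m-1$, entry $\gamma_m$ in column $\nu(j-1)+1$ if $m=\nu(j+1)$ and $j\ge1$, and zeros elsewhere. *)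

theory Defs
  imports "Jordan_Normal_Form.Determinant" "HOL-Library.Extended_Nat"
    "HOL-Computational_Algebra.Polynomial"
begin

definition linear_functional :: "(complex poly \<Rightarrow> complex) \<Rightarrow> bool" where
  "linear_functional L \<longleftrightarrow> Vector_Spaces.linear Polynomial.smult (*) L"

definition moment :: "(complex poly \<Rightarrow> complex) \<Rightarrow> nat \<Rightarrow> complex" where
  "moment L k = L (Polynomial.monom 1 k)"

text \<open>The \<open>k \<times> k\<close> Hankel matrix of moments, usually written \<open>H\<^bsub>k-1\<^esub>\<close>; its determinant is
  \<open>\<Delta>\<^bsub>k-1\<^esub>\<close>. Here the index is the size of the matrix.\<close>

definition hankel_mat :: "(complex poly \<Rightarrow> complex) \<Rightarrow> nat \<Rightarrow> complex mat" where
  "hankel_mat L k = mat k k (\<lambda>(i, j). moment L (i + j))"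

definition hankel_det :: "(complex poly \<Rightarrow> complex) \<Rightarrow> nat \<Rightarrow> complex" where
  "hankel_det L k = det (hankel_mat L k)"

text \<open>The condition \<open>p \<noteq> 0\<close> gives the constant polynomials exact degree \<open>0\<close>.\<close>

definition FOP :: "(complex poly \<Rightarrow> complex) \<Rightarrow> complex poly \<Rightarrow> bool" where
  "FOP L p \<longleftrightarrow> p \<noteq> 0 \<and> (\<forall>j < Polynomial.degree p. L (p * Polynomial.monom 1 j) = 0)"

definition regular_FOP :: "(complex poly \<Rightarrow> complex) \<Rightarrow> complex poly \<Rightarrow> bool" where
  "regular_FOP L p \<longleftrightarrow>
     FOP L p \<and> (Polynomial.degree p = 0 \<or> hankel_det L (Polynomial.degree p) \<noteq> 0)"

definition quasi_orthogonal :: "(complex poly \<Rightarrow> complex) \<Rightarrow> nat \<Rightarrow> complex poly \<Rightarrow> bool" where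
  "quasi_orthogonal L k p \<longleftrightarrow>
     p \<noteq> 0 \<and> (\<forall>j. j + k < Polynomial.degree p \<longrightarrow> L (p * Polynomial.monom 1 j) = 0)"

text \<open>The indices of the regular FOPs in increasing order. Since \<open>Inf {} = \<infinity>\<close> in \<open>enat\<close>, the
  value is \<open>\<infinity>\<close> from the first step after the last regular index onwards.\<close>

primrec nu :: "(complex poly \<Rightarrow> complex) \<Rightarrow> nat \<Rightarrow> enat" where
  "nu L 0 = 0"
| "nu L (Suc t) = Inf {enat n |n. nu L t < enat n \<and> hankel_det L n \<noteq> 0}"

definition associated_seq :: "(complex poly \<Rightarrow> complex) \<Rightarrow> (nat \<Rightarrow> complex poly) \<Rightarrow> bool" where
  "associated_seq L p \<longleftrightarrow>
     (\<forall>n. p n \<noteq> 0 \<and> Polynomial.degree (p n) = n) \<and>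
     (\<forall>t n. nu L t = enat n \<longrightarrow> regular_FOP L (p n)) \<and>
     (\<forall>t a n. nu L t = enat a \<and> a < n \<and> enat n < nu L (Suc t)
        \<longrightarrow> quasi_orthogonal L (n - a) (p n))"

text \<open>The coefficients \<open>\<alpha>\<close>, \<open>\<beta>\<close>, \<open>\<gamma>\<close> of the recurrences satisfied by an associated sequence.
  With \<open>nu L j = a\<close>, the first recurrence holds for \<open>n\<close> strictly inside the block that starts
  at \<open>a\<close>, the second for \<open>n = nu L (j + 1)\<close>. For \<open>j = 0\<close> there is no \<open>\<gamma>\<close> term, by the convention
  that the polynomial with index \<open>\<nu>(-1)\<close> is \<open>0\<close>. The only values of \<open>\<alpha>\<close>, \<open>\<beta>\<close>, \<open>\<gamma>\<close> used later are
  those occurring here, and they are determined by \<open>L\<close> and \<open>p\<close>.\<close>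

definition recurrence_coeffs ::
  "(complex poly \<Rightarrow> complex) \<Rightarrow> (nat \<Rightarrow> complex poly) \<Rightarrow>
   (nat \<Rightarrow> nat \<Rightarrow> complex) \<Rightarrow> (nat \<Rightarrow> complex) \<Rightarrow> (nat \<Rightarrow> complex) \<Rightarrow> bool" where
  "recurrence_coeffs L p \<alpha> \<beta> \<gamma> \<longleftrightarrow>
     (\<forall>n\<ge>1. \<beta> n \<noteq> 0) \<and>
     (\<forall>n. nu L 1 = enat n \<longrightarrow> \<gamma> n = 0) \<and>
     (\<forall>j a n. nu L j = enat a \<and> a < n \<and> enat n < nu L (Suc j) \<longrightarrow>
        Polynomial.smult (\<beta> n) (p n) =
          [:0, 1:] * p (n - 1) - (\<Sum>i = a..n - 1. Polynomial.smult (\<alpha> n i) (p i))) \<and>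
     (\<forall>j a n. nu L j = enat a \<and> enat n = nu L (Suc j) \<longrightarrow>
        Polynomial.smult (\<beta> n) (p n) =
          [:0, 1:] * p (n - 1) - (\<Sum>i = a..n - 1. Polynomial.smult (\<alpha> n i) (p i))
          - (if j = 0 then 0 else Polynomial.smult (\<gamma> n) (p (the_enat (nu L (j - 1))))))"

definition block_index :: "(complex poly \<Rightarrow> complex) \<Rightarrow> nat \<Rightarrow> nat" where
  "block_index L m = (THE j. nu L j < enat m \<and> enat m \<le> nu L (Suc j))"

text \<open>Rows and columns are counted from \<open>0\<close>: the entry at \<open>(r, c)\<close> is the one in row \<open>m = r + 1\<close>
  and column \<open>c + 1\<close> of the matrix counted from \<open>1\<close>, that is, the coefficient of \<open>p c\<close> in the
  recurrence for \<open>\<lambda> p (m - 1)\<close>.\<close>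

definition T_mat ::
  "(complex poly \<Rightarrow> complex) \<Rightarrow> (nat \<Rightarrow> nat \<Rightarrow> complex) \<Rightarrow> (nat \<Rightarrow> complex) \<Rightarrow>
   (nat \<Rightarrow> complex) \<Rightarrow> nat \<Rightarrow> complex mat" where
  "T_mat L \<alpha> \<beta> \<gamma> n = mat n n (\<lambda>(r, c).
     let m = r + 1; j = block_index L m in
       if c = m then \<beta> m
       else if the_enat (nu L j) \<le> c \<and> c < m then \<alpha> m c
       else if enat m = nu L (Suc j) \<and> 1 \<le> j \<and> c = the_enat (nu L (j - 1)) then \<gamma> m
       else 0)"

end

theory Submission
  imports Defs
begin

text \<open>
  The matrix \<open>T\<close> represents multiplication by \<open>\<lambda>\<close> modulo \<open>p n\<close> in the basis
  \<open>p 0, \<dots>, p (n - 1)\<close>. The first row of its \<open>k\<close>-th power therefore holds the coordinates \<open>c\<^sub>i\<close> of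
  the remainder in \<open>\<lambda>\<^sup>k p\<^sub>0 = \<Sum>\<^sub>i c\<^sub>i p\<^sub>i + q p\<^sub>n\<close> (lemmas \<open>T_mat_row\<close> and \<open>T_mat_power_row\<close>), and comparing
  degrees shows that \<open>q = 0\<close> or \<open>q\<close> has degree at most \<open>k - n\<close>. Applying \<open>L\<close> turns the left side
  into a constant multiple of the moment \<open>m\<^sub>k\<close>.

  On the right side only one coordinate survives. A regular polynomial \<open>P\<close> of degree \<open>a = \<nu>(t)\<close>
  is orthogonal not only to the powers below its degree but to all \<open>\<lambda>\<^sup>j\<close> with \<open>j + 1 < \<nu>(t + 1)\<close>: the
  first \<open>j\<close> for which this fails would make the Hankel determinant of size \<open>j + 1\<close> nonzero, so
  \<open>j + 1\<close> would be a regular index inside the gap (lemma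
  \<open>regular_FOP_orthogonal_up_to_gap\<close>). For \<open>P = 1\<close> this says that \<open>m\<^sub>j = 0\<close> for
  \<open>j < \<nu>(1) - 1\<close>, hence \<open>L\<close> vanishes on \<open>p i\<close> for \<open>i < \<nu>(1) - 1\<close>; for \<open>i \<ge> \<nu>(1)\<close> it
  vanishes by quasi-orthogonality to \<open>1\<close>. What remains is \<open>i = \<nu>(1) - 1\<close>, where \<open>L (p i)\<close> is the
  leading coefficient times the moment with index \<open>\<nu>(1) - 1\<close>, and the leading coefficient comes
  from the recurrence (lemma \<open>lead_coeff_associated_seq\<close>); it produces the factor \<open>\<mu>\<close>.

  The error term \<open>L (q * p n)\<close> vanishes in the whole range of \<open>k\<close> because quasi-orthogonality
  inside a gap is divisibility: \<open>p n = w * P\<close> for the last regular polynomial \<open>P\<close> before it (lemma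
  \<open>orthogonal_in_gap_is_multiple\<close>). Then \<open>q * w\<close> has degree at most \<open>k - \<nu>(t)\<close>, and
  \<open>k - \<nu>(t) + 1 < \<nu>(t + 1)\<close> is exactly the bound on \<open>k\<close>.
\<close>

section \<open>Linear functionals and Hankel determinants\<close>

lemma linear_functional_simps:
  assumes "linear_functional L"
  shows linear_functional_add: "L (f + g) = L f + L g"
    and linear_functional_smult: "L (Polynomial.smult c f) = c * L f"
    and linear_functional_zero: "L 0 = 0"
    and linear_functional_sum: "L (sum F A) = (\<Sum>a\<in>A. L (F a))"
proof -
  interpret Vector_Spaces.linear Polynomial.smult "(*)" L
    using assms by (simp add: linear_functional_def)
  show "L (f + g) = L f + L g" "L (Polynomial.smult c f) = c * L f" "L 0 = 0"
    "L (sum F A) = (\<Sum>a\<in>A. L (F a))"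
    by (simp_all add: add scale zero sum)
qed

lemma functional_mult_expand:
  assumes "linear_functional L" "Polynomial.degree g \<le> d"
  shows "L (f * g) = (\<Sum>i\<le>d. Polynomial.coeff g i * L (f * Polynomial.monom 1 i))"
proof -
  have "f * (\<Sum>i\<le>d. Polynomial.monom (Polynomial.coeff g i) i)
      = (\<Sum>i\<le>d. Polynomial.smult (Polynomial.coeff g i) (f * Polynomial.monom 1 i))"
    unfolding sum_distrib_left
    by (intro sum.cong refl) (simp flip: mult_smult_right add: smult_monom)
  then have "f * g = (\<Sum>i\<le>d. Polynomial.smult (Polynomial.coeff g i) (f * Polynomial.monom 1 i))"
    by (simp only: poly_as_sum_of_monoms'[OF assms(2)])
  then show ?thesis
    using assms(1) by (simp add: linear_functional_simps)
qed

lemma functional_mult_eq_0: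
  assumes "linear_functional L"
    and "\<And>i. i \<le> Polynomial.degree g \<Longrightarrow> L (f * Polynomial.monom 1 i) = 0"
  shows "L (f * g) = 0"
  by (subst functional_mult_expand[OF assms(1) order_refl[of "Polynomial.degree g"]])
    (simp add: assms(2))

lemma functional_mult_lead:
  assumes "linear_functional L" "Polynomial.degree g \<le> d"
    and "\<And>i. i < d \<Longrightarrow> L (f * Polynomial.monom 1 i) = 0"
  shows "L (f * g) = Polynomial.coeff g d * L (f * Polynomial.monom 1 d)"
  by (subst functional_mult_expand[OF assms(1,2)])
    (simp add: assms(3) flip: lessThan_Suc_atMost)

lemma hankel_mat_mult_coeffs:
  assumes "linear_functional L" "Polynomial.degree f < n" "i < n"
  shows "(hankel_mat L n *\<^sub>v vec n (Polynomial.coeff f)) $ i = L (f * Polynomial.monom 1 i)"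
proof -
  have "L (Polynomial.monom 1 i * f)
      = (\<Sum>j\<le>n - 1. Polynomial.coeff f j * L (Polynomial.monom 1 i * Polynomial.monom 1 j))"
    using functional_mult_expand[OF assms(1), of f "n - 1" "Polynomial.monom 1 i"] assms by simp
  also have "\<dots> = (\<Sum>j\<in>{0..<n}. moment L (i + j) * Polynomial.coeff f j)"
    using assms
    by (intro sum.cong) (auto simp: moment_def mult_monom)
  finally show ?thesis
    using assms(3) by (simp add: hankel_mat_def scalar_prod_def mult.commute)
qed

text \<open>A kernel vector of the Hankel matrix is the coefficient vector of a polynomial of too
  small degree orthogonal to all the powers that are tested. Every use of a Hankel determinant
  goes through this reformulation.\<close>

lemma hankel_det_nonzero_iff:
  assumes L: "linear_functional L"
  shows "hankel_det L n \<noteq> 0 \<longleftrightarrow>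
    (\<forall>f. Polynomial.degree f < n \<and> (\<forall>i<n. L (f * Polynomial.monom 1 i) = 0) \<longrightarrow> f = 0)"
proof -
  have carrier: "hankel_mat L n \<in> carrier_mat n n"
    by (simp add: hankel_mat_def)
  note det_iff = det_0_iff_vec_prod_zero[OF carrier, folded hankel_det_def]
  show ?thesis
  proof (intro iffI allI impI)
    fix f assume det: "hankel_det L n \<noteq> 0"
      and f: "Polynomial.degree f < n \<and> (\<forall>i<n. L (f * Polynomial.monom 1 i) = 0)"
    have "hankel_mat L n *\<^sub>v vec n (Polynomial.coeff f) = 0\<^sub>v n"
      using f hankel_mat_mult_coeffs[OF L, of f n] carrier by (intro eq_vecI) auto
    then have vec0: "vec n (Polynomial.coeff f) = 0\<^sub>v n"
      using det det_iff by (metis vec_carrier)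
    have "Polynomial.coeff f i = 0" if "i < n" for i
      using arg_cong[OF vec0, of "\<lambda>v. v $ i"] that by simp
    then show "f = 0"
      using f by (metis leading_coeff_0_iff)
  next
    assume trivial: "\<forall>f. Polynomial.degree f < n \<and>
      (\<forall>i<n. L (f * Polynomial.monom 1 i) = 0) \<longrightarrow> f = 0"
    show "hankel_det L n \<noteq> 0"
    proof
      assume "hankel_det L n = 0"
      then obtain v where v: "v \<in> carrier_vec n" "v \<noteq> 0\<^sub>v n" "hankel_mat L n *\<^sub>v v = 0\<^sub>v n"
        using det_iff by auto
      define f where "f = (\<Sum>i<n. Polynomial.monom (v $ i) i)"
      have coeff_f: "Polynomial.coeff f i = (if i < n then v $ i else 0)" for i
        by (auto simp: f_def Polynomial.coeff_sum if_distrib cong: if_cong)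
      have n: "n > 0"
        using v by (cases n) auto
      have deg: "Polynomial.degree f < n"
        unfolding f_def
        by (rule degree_sum_less[OF _ n]) (meson degree_monom_le le_less_trans lessThan_iff)
      have vec: "vec n (Polynomial.coeff f) = v"
        using v(1) by (intro eq_vecI) (auto simp: coeff_f)
      have "L (f * Polynomial.monom 1 i) = 0" if "i < n" for i
        using hankel_mat_mult_coeffs[OF L deg that] v(3) that by (simp add: vec)
      then have "f = 0"
        using trivial deg by blast
      then show False
        using v vec by auto
    qed
  qed
qed

section \<open>The indices of the regular orthogonal polynomials\<close>

lemma nu_Suc_greater:
  assumes "nu L t = enat a"
  shows "nu L t < nu L (Suc t)"
proof (rule ccontr)
  assume "\<not> nu L t < nu L (Suc t)"
  then have le: "nu L (Suc t) < enat (Suc a)"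
    using assms by (simp add: not_less le_less_trans)
  then obtain x where "x \<in> {enat n |n. nu L t < enat n \<and> hankel_det L n \<noteq> 0}" "x < enat (Suc a)"
    by (auto simp: Inf_less_iff)
  then show False
    using assms by auto
qed

lemma nu_mono: "i \<le> j \<Longrightarrow> nu L i \<le> nu L j"
proof (rule lift_Suc_mono_le[of "nu L"])
  show "nu L m \<le> nu L (Suc m)" for m
  proof (cases "nu L m")
    case (enat a)
    then show ?thesis using nu_Suc_greater[of L m a] by simp
  next
    case infinity
    then show ?thesis by (simp add: top_enat_def[symmetric])
  qed
qed

lemma nu_ge: "enat t \<le> nu L t"
proof (induction t)
  case 0
  then show ?case by (simp add: zero_enat_def)
next
  case (Suc t)
  show ?case
  proof (cases "nu L t")
    case (enat a)
    then have "nu L t < nu L (Suc t)"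
      by (rule nu_Suc_greater)
    then show ?thesis
      using Suc enat by (cases "nu L (Suc t)") auto
  next
    case infinity
    then show ?thesis
      using nu_mono[of t "Suc t" L] by simp
  qed
qed

lemma nu_hankel_det_nonzero:
  assumes "nu L t = enat a"
  shows "hankel_det L a \<noteq> 0"
proof (cases t)
  case 0
  then have "a = 0"
    using assms by (simp add: zero_enat_def)
  then show ?thesis
    by (simp add: hankel_det_def hankel_mat_def)
next
  case (Suc s)
  let ?S = "{enat n |n. nu L s < enat n \<and> hankel_det L n \<noteq> 0}"
  have inf: "Inf ?S = enat a"
    using assms Suc by simp
  then have "?S \<noteq> {}"
    by (metis Inf_empty enat.distinct(1) top_enat_def)
  then have "Inf ?S \<in> ?S"
    by (meson ex_in_conv wellorder_InfI)
  then show ?thesis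
    using inf by auto
qed

lemma hankel_det_zero_between:
  assumes "nu L t < enat n" "enat n < nu L (Suc t)"
  shows "hankel_det L n = 0"
proof (rule ccontr)
  assume "hankel_det L n \<noteq> 0"
  then have "nu L (Suc t) \<le> enat n"
    using assms(1) by (auto intro!: Inf_lower)
  then show False
    using assms(2) by simp
qed

lemma nu_interval_exists:
  obtains s where "nu L s \<le> enat i" "enat i < nu L (Suc s)"
proof -
  define s where "s = (LEAST s. enat i < nu L (Suc s))"
  have ex: "enat i < nu L (Suc i)"
    using nu_ge[of "Suc i" L] by (metis Suc_ile_eq)
  have upper: "enat i < nu L (Suc s)"
    unfolding s_def using ex by (rule LeastI)
  have "nu L s \<le> enat i"
  proof (cases s)
    case 0
    then show ?thesis by simp
  next
    case (Suc r)
    then have "\<not> enat i < nu L (Suc r)"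
      unfolding s_def using not_less_Least[of r "\<lambda>s. enat i < nu L (Suc s)"] by auto
    then show ?thesis using Suc by simp
  qed
  then show thesis using upper that by blast
qed

lemma block_index_props:
  assumes "m \<ge> 1"
  shows "nu L (block_index L m) < enat m" "enat m \<le> nu L (Suc (block_index L m))"
proof -
  let ?P = "\<lambda>j. nu L j < enat m \<and> enat m \<le> nu L (Suc j)"
  obtain s where s: "nu L s \<le> enat (m - 1)" "enat (m - 1) < nu L (Suc s)"
    by (rule nu_interval_exists)
  have "nu L s < enat m"
  proof (rule le_less_trans[OF s(1)])
    show "enat (m - 1) < enat m" using assms by simp
  qed
  moreover have "enat m \<le> nu L (Suc s)"
    using s(2) assms Suc_ile_eq[of "m - 1"] by simp
  ultimately have Ps: "?P s" ..
  have "j = s" if "?P j" for j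
  proof (rule ccontr)
    assume "j \<noteq> s"
    then consider "Suc j \<le> s" | "Suc s \<le> j" by linarith
    then show False
    proof cases
      case 1
      then show False
        using that Ps nu_mono[of "Suc j" s L] by (meson leD order_trans)
    next
      case 2
      then show False
        using that Ps nu_mono[of "Suc s" j L] by (meson leD order_trans)
    qed
  qed
  then have "?P (block_index L m)"
    unfolding block_index_def using Ps by (intro theI[of ?P s])
  then show "nu L (block_index L m) < enat m" "enat m \<le> nu L (Suc (block_index L m))"
    by simp_all
qed

section \<open>Orthogonality beyond the degree\<close>

text \<open>
  By induction, let \<open>j\<close> be the first power beyond the degree at which orthogonality could fail. If
  \<open>L (P * \<lambda>\<^sup>j) \<noteq> 0\<close>, then the Hankel matrix of size \<open>j + 1\<close> has trivial kernel: dividing a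
  kernel polynomial by \<open>P\<close>, a nonzero quotient \<open>w\<close> would be detected by the test polynomial
  \<open>P * \<lambda>\<^sup>i\<close> that brings \<open>w * P * \<lambda>\<^sup>i\<close> to degree \<open>j\<close>, and a pure remainder lies in the kernel of the
  invertible Hankel matrix of size \<open>a\<close>. The case \<open>t = 0\<close>, with \<open>P\<close> constant, is included and
  describes the initial zero moments.
\<close>

lemma regular_FOP_orthogonal_up_to_gap:
  assumes L: "linear_functional L" and a: "nu L t = enat a"
    and P: "FOP L P" "Polynomial.degree P = a"
  shows "enat (Suc j) < nu L (Suc t) \<Longrightarrow> L (P * Polynomial.monom 1 j) = 0"
proof (induction j rule: less_induct)
  case (less j)
  have small: "L (P * Polynomial.monom 1 i) = 0" if "i < j" for i
    using less.IH[OF that] less.prems that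
    by (meson Suc_mono enat_ord_simps(2) less_trans)
  show ?case
  proof (cases "j < a")
    case True
    then show ?thesis using P by (simp add: FOP_def)
  next
    case False
    show ?thesis
    proof (rule ccontr)
      assume nz: "L (P * Polynomial.monom 1 j) \<noteq> 0"
      have P0: "P \<noteq> 0" using P by (simp add: FOP_def)
      have "hankel_det L (Suc j) \<noteq> 0"
        unfolding hankel_det_nonzero_iff[OF L]
      proof (intro allI impI)
        fix f
        assume f: "Polynomial.degree f < Suc j \<and> (\<forall>i<Suc j. L (f * Polynomial.monom 1 i) = 0)"
        define w where "w = f div P"
        define r where "r = f mod P"
        have f_eq: "f = w * P + r" by (simp add: w_def r_def)
        have r: "r = 0 \<or> Polynomial.degree r < a"
          using degree_mod_less[OF P0, of f] P(2) by (simp add: r_def)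
        have "w = 0"
        proof (rule ccontr)
          assume w: "w \<noteq> 0"
          define d where "d = Polynomial.degree w"
          have deg_wP: "Polynomial.degree (w * P) = d + a"
            using w P0 P(2) by (simp add: degree_mult_eq d_def)
          have "Polynomial.degree f = d + a"
            using r deg_wP unfolding f_eq
            by (auto simp: degree_add_eq_left)
          then have d: "d + a \<le> j" using f by simp
          \<comment> \<open>This exponent gives \<open>w * P * X\<close> degree exactly \<open>j\<close>, while \<open>r * X\<close> stays below
            degree \<open>j\<close> and is killed by \<open>P\<close>.\<close>
          define i where "i = j - a - d"
          define X :: "complex poly" where "X = Polynomial.monom 1 i"
          have X: "X \<noteq> 0" "Polynomial.degree X = i"
            by (simp_all add: X_def degree_monom_eq monom_eq_0_iff)
          have "L (f * (P * X)) = 0"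
          proof (rule functional_mult_eq_0[OF L])
            fix k assume "k \<le> Polynomial.degree (P * X)"
            then have "k < Suc j"
              using X P0 P(2) d by (simp add: degree_mult_eq i_def)
            then show "L (f * Polynomial.monom 1 k) = 0" using f by blast
          qed
          moreover have "L (P * (r * X)) = 0"
          proof (cases "r = 0")
            case True
            then show ?thesis using L by (simp add: linear_functional_simps)
          next
            case False
            show ?thesis
            proof (rule functional_mult_eq_0[OF L])
              fix k assume "k \<le> Polynomial.degree (r * X)"
              then have "k < j"
                using X r False d by (simp add: degree_mult_eq i_def)
              then show "L (P * Polynomial.monom 1 k) = 0" by (rule small)
            qed
          qed
          moreover have "f * (P * X) = P * (w * P * X) + P * (r * X)"
            by (simp add: f_eq algebra_simps)
          ultimately have zero: "L (P * (w * P * X)) = 0"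
            using L by (simp add: linear_functional_simps)
          have deg: "Polynomial.degree (w * P * X) = j"
            using w P0 X d deg_wP by (simp add: degree_mult_eq i_def)
          have "w * P * X \<noteq> 0" using w P0 X by simp
          then have "Polynomial.coeff (w * P * X) j \<noteq> 0"
            using deg by (metis leading_coeff_0_iff)
          moreover have "L (P * (w * P * X))
              = Polynomial.coeff (w * P * X) j * L (P * Polynomial.monom 1 j)"
            using small deg by (intro functional_mult_lead[OF L]) simp_all
          ultimately show False using zero nz by simp
        qed
        then have "f = r" by (simp add: f_eq)
        moreover have "\<forall>i<a. L (f * Polynomial.monom 1 i) = 0"
          using f False by simp
        ultimately show "f = 0"
          using r nu_hankel_det_nonzero[OF a] unfolding hankel_det_nonzero_iff[OF L] by blast
      qed
      moreover have "hankel_det L (Suc j) = 0"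
        using less.prems False a by (intro hankel_det_zero_between[of L t]) auto
      ultimately show False by simp
    qed
  qed
qed

text \<open>
  The remainder of \<open>f\<close> modulo \<open>P\<close> inherits the orthogonality to the powers below \<open>a\<close>, because the
  multiple of \<open>P\<close> that is subtracted is itself orthogonal to them as long as the degree of \<open>f\<close> stays
  inside the gap. Regularity of the index \<open>a\<close> then forces the remainder to be zero.
\<close>

lemma orthogonal_in_gap_is_multiple:
  assumes L: "linear_functional L" and a: "nu L t = enat a"
    and P: "FOP L P" "Polynomial.degree P = a"
    and n: "enat (Polynomial.degree f) < nu L (Suc t)"
    and orth: "\<And>i. i < a \<Longrightarrow> L (f * Polynomial.monom 1 i) = 0"
  shows "P dvd f"
proof -
  have P0: "P \<noteq> 0" using P by (simp add: FOP_def)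
  define w where "w = f div P"
  define r where "r = f mod P"
  have f_eq: "f = w * P + r" by (simp add: w_def r_def)
  have r: "r = 0 \<or> Polynomial.degree r < a"
    using degree_mod_less[OF P0, of f] P(2) by (simp add: r_def)
  have "L (r * Polynomial.monom 1 i) = 0" if i: "i < a" for i
  proof -
    have "L (P * (w * Polynomial.monom 1 i)) = 0"
    proof (cases "w = 0")
      case True
      then show ?thesis using L by (simp add: linear_functional_simps)
    next
      case False
      then have wP: "Polynomial.degree (w * P) = Polynomial.degree w + a"
        using P0 P(2) by (simp add: degree_mult_eq)
      then have deg_f: "Polynomial.degree f = Polynomial.degree w + a"
        using r unfolding f_eq by (auto simp: degree_add_eq_left)
      show ?thesis
      proof (rule functional_mult_eq_0[OF L])
        fix k assume "k \<le> Polynomial.degree (w * Polynomial.monom 1 i)"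
        then have "Suc k \<le> Polynomial.degree f"
          using False i deg_f by (simp add: degree_mult_eq monom_eq_0_iff degree_monom_eq)
        then have "enat (Suc k) < nu L (Suc t)"
          using n by (meson enat_ord_simps(1) le_less_trans)
        then show "L (P * Polynomial.monom 1 k) = 0"
          by (rule regular_FOP_orthogonal_up_to_gap[OF L a P])
      qed
    qed
    moreover have "f * Polynomial.monom 1 i
        = P * (w * Polynomial.monom 1 i) + r * Polynomial.monom 1 i"
      by (simp add: f_eq algebra_simps)
    ultimately show ?thesis
      using orth[OF i] L by (simp add: linear_functional_simps)
  qed
  then have "r = 0"
    using r nu_hankel_det_nonzero[OF a] unfolding hankel_det_nonzero_iff[OF L] by blast
  then show ?thesis by (simp add: f_eq)
qed

section \<open>Associated sequences\<close>

lemma associated_seq_nonzero: "associated_seq L p \<Longrightarrow> p n \<noteq> 0"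
  and associated_seq_degree: "associated_seq L p \<Longrightarrow> Polynomial.degree (p n) = n"
  by (simp_all add: associated_seq_def)

lemma associated_seq_FOP: "associated_seq L p \<Longrightarrow> nu L t = enat a \<Longrightarrow> FOP L (p a)"
  by (simp add: associated_seq_def regular_FOP_def)

lemma associated_seq_orthogonal:
  assumes p: "associated_seq L p" and a: "nu L t = enat a" "a \<le> n" "enat n < nu L (Suc t)"
    and "i < a"
  shows "L (p n * Polynomial.monom 1 i) = 0"
proof (cases "a = n")
  case True
  then show ?thesis
    using associated_seq_FOP[OF p a(1)] associated_seq_degree[OF p, of a] \<open>i < a\<close>
    by (simp add: FOP_def)
next
  case False
  then have "quasi_orthogonal L (n - a) (p n)"
    using p a unfolding associated_seq_def by (metis le_neq_implies_less)
  then show ?thesis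
    using associated_seq_degree[OF p, of n] \<open>i < a\<close> a(2) by (simp add: quasi_orthogonal_def)
qed

text \<open>
  Writing \<open>p n\<close> as a multiple of \<open>p a\<close> trades the degree \<open>n\<close> for the degree \<open>a\<close>; with
  the orthogonality of \<open>p n\<close> to the powers below \<open>a\<close> alone, only the moments with \<open>k < n + a\<close>
  would be reached.
\<close>

lemma functional_remainder_zero:
  assumes L: "linear_functional L" and p: "associated_seq L p"
    and a: "nu L t = enat a" "a \<le> n" "enat n < nu L (Suc t)"
    and q: "q = 0 \<or> Polynomial.degree q + n \<le> k"
    and k: "enat k + 2 \<le> nu L t + nu L (Suc t)"
  shows "L (q * p n) = 0"
proof (cases "q = 0")
  case True
  then show ?thesis using L by (simp add: linear_functional_simps)
next
  case False
  have "p a dvd p n"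
    using a p associated_seq_FOP[OF p a(1)] associated_seq_degree[OF p]
      associated_seq_orthogonal[OF p a]
    by (intro orthogonal_in_gap_is_multiple[OF L a(1)]) simp_all
  then obtain w where w: "p n = p a * w" ..
  have w0: "w \<noteq> 0" "p a \<noteq> 0"
    using w associated_seq_nonzero[OF p, of n] by auto
  then have deg_w: "a + Polynomial.degree w = n"
    using arg_cong[OF w, of Polynomial.degree] associated_seq_degree[OF p]
    by (simp add: degree_mult_eq)
  have "L (p a * (w * q)) = 0"
  proof (rule functional_mult_eq_0[OF L])
    fix i assume "i \<le> Polynomial.degree (w * q)"
    then have "a + i \<le> k"
      using q False w0 deg_w by (simp add: degree_mult_eq)
    then have "enat (Suc i) < nu L (Suc t)"
      using k a(1) by (cases "nu L (Suc t)") (auto simp: numeral_eq_enat)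
    then show "L (p a * Polynomial.monom 1 i) = 0"
      using regular_FOP_orthogonal_up_to_gap[OF L a(1) associated_seq_FOP[OF p a(1)]]
        associated_seq_degree[OF p] by blast
  qed
  then show ?thesis by (simp add: w algebra_simps)
qed

text \<open>
  Below \<open>\<nu>1 - 1\<close> the reason is the vanishing of the initial moments, from \<open>\<nu>1\<close> on it is the
  orthogonality of \<open>p i\<close> to constants.
\<close>

lemma functional_associated_seq_zero:
  assumes L: "linear_functional L" and p: "associated_seq L p"
    and \<nu>: "nu L 1 = enat \<nu>1" and i: "i \<noteq> \<nu>1 - 1"
  shows "L (p i) = 0"
proof (cases "i < \<nu>1")
  case True
  have nu0: "nu L 0 = enat 0" by (simp add: zero_enat_def)
  have 0: "FOP L 1" by (simp add: FOP_def)
  have "L (1 * p i) = 0"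
  proof (rule functional_mult_eq_0[OF L])
    fix j assume "j \<le> Polynomial.degree (p i)"
    then have "enat (Suc j) < nu L (Suc 0)"
      using associated_seq_degree[OF p] True i \<nu> by (simp del: nu.simps)
    then show "L (1 * Polynomial.monom 1 j) = 0"
      by (rule regular_FOP_orthogonal_up_to_gap[OF L nu0 0 degree_1])
  qed
  then show ?thesis by simp
next
  case False
  obtain s where s: "nu L s \<le> enat i" "enat i < nu L (Suc s)"
    by (rule nu_interval_exists)
  then obtain a where a: "nu L s = enat a"
    by (metis enat_ile)
  have "s \<noteq> 0"
    using s(2) \<nu> False by (intro notI) (simp del: nu.simps(2))
  then have "0 < a"
    using nu_ge[of s L] a by simp
  moreover have "a \<le> i"
    using s(1) a by simp
  ultimately have "L (p i * Polynomial.monom 1 0) = 0"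
    using s(2) by (intro associated_seq_orthogonal[OF p a])
  then show ?thesis by simp
qed

lemma moment_zero_before_first_index:
  assumes "linear_functional L" "nu L 1 = enat \<nu>1" "Suc j < \<nu>1"
  shows "moment L j = 0"
proof -
  have nu0: "nu L 0 = enat 0" by (simp add: zero_enat_def)
  have "FOP L 1" by (simp add: FOP_def)
  then show ?thesis
    using regular_FOP_orthogonal_up_to_gap[OF assms(1) nu0, of 1 j] assms(2,3)
    by (simp add: moment_def del: nu.simps(2))
qed

section \<open>The recurrence in matrix form\<close>

text \<open>
  Up to the first regular index, \<open>\<beta> (i + 1) * p (i + 1)\<close> and \<open>\<lambda> * p i\<close> differ by terms of degree
  at most \<open>i\<close>, so the leading coefficient is divided by \<open>\<beta> (i + 1)\<close> in each step.
\<close>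

lemma lead_coeff_associated_seq:
  assumes p: "associated_seq L p" and rec: "recurrence_coeffs L p \<alpha> \<beta> \<gamma>"
    and \<nu>: "nu L 1 = enat \<nu>1"
  shows "i < \<nu>1 \<Longrightarrow> (\<Prod>j = 1..i. \<beta> j) * Polynomial.coeff (p i) i = Polynomial.coeff (p 0) 0"
proof (induction i)
  case 0
  then show ?case by simp
next
  case (Suc i)
  have "nu L 0 = enat 0 \<and> 0 < Suc i \<and> enat (Suc i) < nu L (Suc 0)"
    using Suc.prems \<nu> by (simp add: zero_enat_def del: nu.simps(2))
  then have "Polynomial.smult (\<beta> (Suc i)) (p (Suc i)) = [:0, 1:] * p (Suc i - 1)
      - (\<Sum>j = 0..Suc i - 1. Polynomial.smult (\<alpha> (Suc i) j) (p j))"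
    using rec unfolding recurrence_coeffs_def by blast
  then have "Polynomial.smult (\<beta> (Suc i)) (p (Suc i)) =
      [:0, 1:] * p i - (\<Sum>j = 0..i. Polynomial.smult (\<alpha> (Suc i) j) (p j))"
    by simp
  then have "\<beta> (Suc i) * Polynomial.coeff (p (Suc i)) (Suc i) = Polynomial.coeff
      ([:0, 1:] * p i - (\<Sum>j = 0..i. Polynomial.smult (\<alpha> (Suc i) j) (p j))) (Suc i)"
    by (metis Polynomial.coeff_smult)
  also have "\<dots> = Polynomial.coeff (p i) i"
    using associated_seq_degree[OF p]
    by (simp add: Polynomial.coeff_sum coeff_eq_0)
  finally show ?case
    using Suc by (simp add: mult.assoc)
qed

text \<open>
  This merges the two recurrences into the vector identity that defines the matrix. The entries can
  be added up separately because the column \<open>b\<close> of the \<open>\<gamma>\<close> coefficient lies strictly before the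
  columns \<open>a, \<dots>, r\<close> of the \<open>\<alpha>\<close> coefficients, and \<open>\<beta>\<close> sits after them. In the last row the \<open>\<beta>\<close>
  term falls outside the matrix.
\<close>

lemma T_mat_row:
  assumes rec: "recurrence_coeffs L p \<alpha> \<beta> \<gamma>" and r: "r < n"
  shows "[:0, 1:] * p r = (\<Sum>c<n. Polynomial.smult (T_mat L \<alpha> \<beta> \<gamma> n $$ (r, c)) (p c))
    + (if Suc r = n then Polynomial.smult (\<beta> n) (p n) else 0)"
proof -
  define m where "m = Suc r"
  define j where "j = block_index L m"
  have j: "nu L j < enat m" "enat m \<le> nu L (Suc j)"
    using block_index_props[of m L] by (simp_all add: m_def j_def)
  then obtain a where a: "nu L j = enat a" by (cases "nu L j") auto
  have am: "a < m" using j a by simp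
  define isreg where "isreg \<longleftrightarrow> enat m = nu L (Suc j) \<and> 1 \<le> j"
  define b where "b = the_enat (nu L (j - 1))"
  have b: "b < a" if "1 \<le> j"
  proof -
    have "nu L (j - 1) \<le> enat a"
      using nu_mono[of "j - 1" j L] a by simp
    then obtain b' where b': "nu L (j - 1) = enat b'" by (cases "nu L (j - 1)") auto
    then show ?thesis
      using nu_Suc_greater[OF b'] that a by (simp add: b_def)
  qed
  define G where "G = (if isreg then Polynomial.smult (\<gamma> m) (p b) else 0)"
  have recm: "[:0, 1:] * p r =
      (\<Sum>i = a..r. Polynomial.smult (\<alpha> m i) (p i)) + G + Polynomial.smult (\<beta> m) (p m)"
  proof (cases "enat m = nu L (Suc j)")
    case True
    have "Polynomial.smult (\<beta> m) (p m) =
        [:0, 1:] * p (m - 1) - (\<Sum>i = a..m - 1. Polynomial.smult (\<alpha> m i) (p i))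
        - (if j = 0 then 0 else Polynomial.smult (\<gamma> m) (p b))"
      using rec a True unfolding recurrence_coeffs_def b_def by blast
    then show ?thesis
      using True by (cases "j = 0") (simp_all add: m_def G_def isreg_def algebra_simps)
  next
    case False
    then have "enat m < nu L (Suc j)" using j by simp
    then have "Polynomial.smult (\<beta> m) (p m) =
        [:0, 1:] * p (m - 1) - (\<Sum>i = a..m - 1. Polynomial.smult (\<alpha> m i) (p i))"
      using rec a am unfolding recurrence_coeffs_def by blast
    then show ?thesis
      using False by (simp add: m_def G_def isreg_def algebra_simps)
  qed
  have T_entry: "T_mat L \<alpha> \<beta> \<gamma> n $$ (r, c) =
      (if c = m then \<beta> m else if a \<le> c \<and> c < m then \<alpha> m c
       else if isreg \<and> c = b then \<gamma> m else 0)" if "c < n" for c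
    using r that by (simp add: T_mat_def Let_def m_def j_def b_def isreg_def
      a[unfolded j_def m_def, simplified] del: nu.simps(2))
  have entry: "Polynomial.smult (T_mat L \<alpha> \<beta> \<gamma> n $$ (r, c)) (p c) =
      (if c \<in> {a..r} then Polynomial.smult (\<alpha> m c) (p c) else 0)
      + (if c = b then G else 0)
      + (if c = m then Polynomial.smult (\<beta> m) (p m) else 0)" if "c < n" for c
  proof -
    have "b < a \<or> \<not> isreg" using b isreg_def by blast
    then show ?thesis
      using am unfolding T_entry[OF that] G_def by (auto simp: m_def)
  qed
  have "{..<n} \<inter> {a..r} = {a..r}" using r by auto
  then have alphas: "(\<Sum>c<n. if c \<in> {a..r} then Polynomial.smult (\<alpha> m c) (p c) else 0)
      = (\<Sum>i = a..r. Polynomial.smult (\<alpha> m i) (p i))"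
    by (simp only: sum.inter_restrict[OF finite_lessThan, symmetric])
  have gammas: "(\<Sum>c<n. if c = b then G else 0) = G"
    using b am r by (auto simp: G_def isreg_def m_def)
  have betas: "(\<Sum>c<n. if c = m then Polynomial.smult (\<beta> m) (p m) else 0)
      + (if Suc r = n then Polynomial.smult (\<beta> n) (p n) else 0) = Polynomial.smult (\<beta> m) (p m)"
    using r by (auto simp: m_def)
  have "(\<Sum>c<n. Polynomial.smult (T_mat L \<alpha> \<beta> \<gamma> n $$ (r, c)) (p c)) =
      (\<Sum>c<n. (if c \<in> {a..r} then Polynomial.smult (\<alpha> m c) (p c) else 0)
        + (if c = b then G else 0) + (if c = m then Polynomial.smult (\<beta> m) (p m) else 0))"
    by (intro sum.cong refl entry) simp
  also have "\<dots> = (\<Sum>i = a..r. Polynomial.smult (\<alpha> m i) (p i)) + G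
      + (\<Sum>c<n. if c = m then Polynomial.smult (\<beta> m) (p m) else 0)"
    by (simp only: sum.distrib alphas gammas)
  finally show ?thesis
    unfolding recm using betas by (simp add: add.assoc)
qed

lemma smult_sum_right:
  "Polynomial.smult c (\<Sum>i\<in>S. f i) = (\<Sum>i\<in>S. Polynomial.smult c (f i))"
  by (induction S rule: infinite_finite_induct) (simp_all add: smult_add_right)

text \<open>
  Multiplying by \<open>\<lambda>\<close> acts on the coordinate row by right multiplication with the matrix, and the
  overflow of the last row only changes the multiple of \<open>p n\<close>.
\<close>

lemma T_mat_power_row:
  assumes rec: "recurrence_coeffs L p \<alpha> \<beta> \<gamma>" and n: "n > 0"
  shows "\<exists>q. Polynomial.monom 1 k * p 0 =
    (\<Sum>i<n. Polynomial.smult ((T_mat L \<alpha> \<beta> \<gamma> n ^\<^sub>m k) $$ (0, i)) (p i)) + q * p n"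
proof (induction k)
  case 0
  have "(T_mat L \<alpha> \<beta> \<gamma> n ^\<^sub>m 0) $$ (0, i) = (if i = 0 then 1 else 0)" if "i < n" for i
    using that n by (simp add: T_mat_def)
  then have "(\<Sum>i<n. Polynomial.smult ((T_mat L \<alpha> \<beta> \<gamma> n ^\<^sub>m 0) $$ (0, i)) (p i))
      = (\<Sum>i<n. if i = 0 then p i else 0)"
    by (intro sum.cong) auto
  also have "\<dots> = p 0" using n by simp
  finally show ?case
    by (intro exI[of _ 0]) simp
next
  case (Suc k)
  let ?T = "T_mat L \<alpha> \<beta> \<gamma> n"
  let ?c = "\<lambda>i. (?T ^\<^sub>m k) $$ (0, i)"
  have T: "?T \<in> carrier_mat n n" by (simp add: T_mat_def)
  then have Tk: "?T ^\<^sub>m k \<in> carrier_mat n n" by simp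
  obtain q where q: "Polynomial.monom 1 k * p 0 =
      (\<Sum>i<n. Polynomial.smult (?c i) (p i)) + q * p n"
    using Suc by blast
  have step: "(?T ^\<^sub>m Suc k) $$ (0, l) = (\<Sum>i<n. ?c i * ?T $$ (i, l))" if "l < n" for l
    using T Tk that n by (simp add: scalar_prod_def lessThan_atLeast0)
  have "Polynomial.monom 1 (Suc k) * p 0 = [:0, 1:] * (Polynomial.monom 1 k * p 0)"
    by (simp add: monom_Suc)
  also have "\<dots> = (\<Sum>i<n. Polynomial.smult (?c i) ([:0, 1:] * p i)) + [:0, 1:] * q * p n"
    unfolding q by (simp add: distrib_left sum_distrib_left smult_sum_right mult.assoc)
  also have "(\<Sum>i<n. Polynomial.smult (?c i) ([:0, 1:] * p i)) =
      (\<Sum>i<n. \<Sum>l<n. Polynomial.smult (?c i * ?T $$ (i, l)) (p l))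
      + (\<Sum>i<n. if i = n - 1 then Polynomial.smult (?c i * \<beta> n) (p n) else 0)"
    unfolding sum.distrib[symmetric]
  proof (intro sum.cong refl)
    fix i assume "i \<in> {..<n}"
    then show "Polynomial.smult (?c i) ([:0, 1:] * p i) =
        (\<Sum>l<n. Polynomial.smult (?c i * ?T $$ (i, l)) (p l))
        + (if i = n - 1 then Polynomial.smult (?c i * \<beta> n) (p n) else 0)"
      by (subst T_mat_row[OF rec, of i n]) (auto simp: smult_add_right smult_sum_right)
  qed
  also have "(\<Sum>i<n. \<Sum>l<n. Polynomial.smult (?c i * ?T $$ (i, l)) (p l)) =
      (\<Sum>l<n. Polynomial.smult ((?T ^\<^sub>m Suc k) $$ (0, l)) (p l))"
    by (subst sum.swap) (intro sum.cong refl, simp only: step lessThan_iff smult_sum)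
  also have "(\<Sum>i<n. if i = n - 1 then Polynomial.smult (?c i * \<beta> n) (p n) else 0) =
      [:?c (n - 1) * \<beta> n:] * p n"
    using n by simp
  finally have "Polynomial.monom 1 (Suc k) * p 0 =
      (\<Sum>l<n. Polynomial.smult ((?T ^\<^sub>m Suc k) $$ (0, l)) (p l))
      + ([:?c (n - 1) * \<beta> n:] + [:0, 1:] * q) * p n"
    by (simp only: distrib_right add.assoc)
  then show ?case by blast
qed

section \<open>Moments from powers of the matrix\<close>

theorem theorem5p3:
  fixes L :: "complex poly \<Rightarrow> complex"
    and p :: "nat \<Rightarrow> complex poly"
    and \<alpha> :: "nat \<Rightarrow> nat \<Rightarrow> complex" and \<beta> \<gamma> :: "nat \<Rightarrow> complex"
    and n t k \<nu>1 :: nat and \<mu> :: complex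
  assumes "linear_functional L"
    and "associated_seq L p"
    and "recurrence_coeffs L p \<alpha> \<beta> \<gamma>"
    and "nu L 1 = enat \<nu>1"
    and "\<nu>1 \<le> n"
    and "nu L t \<le> enat n" and "enat n < nu L (Suc t)"
    and "\<mu> = (if \<nu>1 > 1 then inverse (\<Prod>i = 1..\<nu>1 - 1. \<beta> i) else 1)"
    and "enat k + 2 \<le> nu L t + nu L (Suc t)"
  shows "\<mu> * moment L (\<nu>1 - 1) *
      (unit_vec n 0 \<bullet> ((T_mat L \<alpha> \<beta> \<gamma> n ^\<^sub>m k) *\<^sub>v unit_vec n (\<nu>1 - 1))) = moment L k"
proof -
  note L = assms(1) and p = assms(2) and rec = assms(3) and \<nu> = assms(4)
  let ?T = "T_mat L \<alpha> \<beta> \<gamma> n"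
  let ?c = "\<lambda>i. (?T ^\<^sub>m k) $$ (0, i)"
  have "nu L 0 < nu L 1"
    using nu_Suc_greater[of L 0 0] by (simp add: zero_enat_def)
  then have \<nu>_pos: "0 < \<nu>1"
    using \<nu> by (simp add: zero_enat_def)
  then have n: "0 < n" using assms(5) by simp
  obtain a where a: "nu L t = enat a" "a \<le> n"
    using assms(6) by (cases "nu L t") auto
  define S where "S = (\<Sum>i<n. Polynomial.smult (?c i) (p i))"
  obtain q where q: "Polynomial.monom 1 k * p 0 = S + q * p n"
    unfolding S_def using T_mat_power_row[OF rec n] by blast
  \<comment> \<open>The degree of \<open>q\<close> is read off the identity: \<open>S\<close> is a remainder modulo \<open>p n\<close>, so it
    cannot cancel the leading term of \<open>q * p n\<close>.\<close>
  have deg_S: "Polynomial.degree S < n"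
    unfolding S_def
  proof (rule degree_sum_less[OF _ n])
    fix i assume "i \<in> {..<n}"
    then show "Polynomial.degree (Polynomial.smult (?c i) (p i)) < n"
      using associated_seq_degree[OF p, of i] degree_smult_le[of "?c i" "p i"] by simp
  qed
  have deg_q: "q = 0 \<or> Polynomial.degree q + n \<le> k"
  proof (cases "q = 0")
    case False
    then have "Polynomial.degree (q * p n) = Polynomial.degree q + n"
      using associated_seq_nonzero[OF p] associated_seq_degree[OF p] by (simp add: degree_mult_eq)
    moreover from this have "Polynomial.degree (S + q * p n) = Polynomial.degree (q * p n)"
      using deg_S by (intro degree_add_eq_right) simp
    moreover have "Polynomial.degree (Polynomial.monom 1 k * p 0) = k"
      using associated_seq_nonzero[OF p, of 0] associated_seq_degree[OF p, of 0]
      by (simp add: degree_mult_eq monom_eq_0_iff degree_monom_eq)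
    ultimately show ?thesis
      using q by simp
  qed simp
  define e where "e = Polynomial.coeff (p 0) 0"
  have p0: "p 0 = [:e:]"
    using associated_seq_degree[OF p, of 0] by (metis degree_eq_zeroE coeff_pCons_0 e_def)
  have e: "e \<noteq> 0"
    using p0 associated_seq_nonzero[OF p, of 0] by auto
  have "e * moment L k = L (Polynomial.monom 1 k * p 0)"
    using L by (simp add: p0 moment_def linear_functional_simps)
  also have "\<dots> = L S"
    unfolding q using functional_remainder_zero[OF L p a assms(7) deg_q assms(9)] L
    by (simp add: linear_functional_simps)
  also have "\<dots> = (\<Sum>i<n. ?c i * L (p i))"
    unfolding S_def using L by (simp add: linear_functional_simps)
  also have "\<dots> = (\<Sum>i<n. if i = \<nu>1 - 1 then ?c i * L (p i) else 0)"
    using functional_associated_seq_zero[OF L p \<nu>] by (intro sum.cong) auto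
  also have "\<dots> = ?c (\<nu>1 - 1) * L (p (\<nu>1 - 1))"
    using \<nu>_pos assms(5) by simp
  also have "L (p (\<nu>1 - 1)) = \<mu> * e * moment L (\<nu>1 - 1)"
  proof -
    define B where "B = (\<Prod>j = 1..\<nu>1 - 1. \<beta> j)"
    have "e = B * Polynomial.coeff (p (\<nu>1 - 1)) (\<nu>1 - 1)"
      unfolding B_def e_def using \<nu>_pos by (intro lead_coeff_associated_seq[OF p rec \<nu>, symmetric]) simp
    moreover have "B \<noteq> 0"
      using rec by (auto simp: B_def recurrence_coeffs_def)
    moreover have "\<mu> = inverse B"
      using \<nu>_pos assms(8) by (cases "\<nu>1 > 1") (auto simp: B_def)
    ultimately have "Polynomial.coeff (p (\<nu>1 - 1)) (\<nu>1 - 1) = \<mu> * e"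
      by (simp flip: mult.assoc)
    moreover have "L (1 * p (\<nu>1 - 1)) = Polynomial.coeff (p (\<nu>1 - 1)) (\<nu>1 - 1)
        * L (1 * Polynomial.monom 1 (\<nu>1 - 1))"
      using associated_seq_degree[OF p] moment_zero_before_first_index[OF L \<nu>]
      by (intro functional_mult_lead[OF L]) (simp_all add: moment_def)
    ultimately show ?thesis
      by (simp add: moment_def)
  qed
  finally have "e * moment L k = e * (\<mu> * moment L (\<nu>1 - 1) * ?c (\<nu>1 - 1))"
    by (simp add: algebra_simps)
  then have result: "\<mu> * moment L (\<nu>1 - 1) * ?c (\<nu>1 - 1) = moment L k"
    using e by simp
  have Tk: "?T ^\<^sub>m k \<in> carrier_mat n n"
    by (intro pow_carrier_mat) (simp add: T_mat_def)
  have "unit_vec n 0 \<bullet> ((?T ^\<^sub>m k) *\<^sub>v unit_vec n (\<nu>1 - 1)) = ?c (\<nu>1 - 1)"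
    using Tk carrier_matD[OF Tk] n \<nu>_pos assms(5)
    by (simp add: scalar_prod_left_unit scalar_prod_right_unit)
  then show ?thesis
    using result by simp
qed

end
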